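(* There exists a bipartite planar graph $G$ of girth $6$ with a signature $\sigma$ such that $(G,\sigma)$ admits no homomorphism to $C_{-4}$.
   Context: All graphs are finite and simple. A signed graph $(G,\sigma)$ is a graph $G$ with a signature $\sigma:E(G)\to\{+,-\}$. Switching at a set $X\subseteq V(G)$ means flipping the signs of all edges with exactly one end in $X$; two signatures on $G$ are equivalent if one is obtained from the other by switching. A homomorphism $(G,\sigma)\to(H,\pi)$ exists if and only if there are a signature $\sigma'$ equivalent to $\sigma$ and a map $f:V(G)\to V(H)$ such that for every edge $uv$ of $G$, $f(u)f(v)$ is an edge of $H$ with $\pi(f(u)f(v))=\sigma'(uv)$. $C_{-4}$ is the signed 4-cycle on $u_1,u_2,u_3,u_4$ with positive edges $u_1u_2,u_2u_3,u_3u_4$ and negative edge $u_4u_1$. The girth of a graph is the length of its shortest cycle. *)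

theory Defs
  imports "HOL-Analysis.Analysis" "HOL-Library.Extended_Nat"
begin

record 'a graph =
  verts :: "'a set"
  edges :: "'a set set"

definition finite_simple_graph :: "'a graph \<Rightarrow> bool" where
  "finite_simple_graph G \<longleftrightarrow>
     finite (verts G) \<and> (\<forall>e\<in>edges G. e \<subseteq> verts G \<and> card e = 2)"

definition bipartite :: "'a graph \<Rightarrow> bool" where
  "bipartite G \<longleftrightarrow>
     (\<exists>A B. A \<union> B = verts G \<and> A \<inter> B = {} \<and> (\<forall>e\<in>edges G. \<exists>a\<in>A. \<exists>b\<in>B. e = {a, b}))"

text \<open>A cycle is given by the cyclic list of its vertices, so its length is the length of the list.\<close>

definition is_cycle :: "'a graph \<Rightarrow> 'a list \<Rightarrow> bool" where
  "is_cycle G vs \<longleftrightarrow>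
     3 \<le> length vs \<and> distinct vs \<and> set vs \<subseteq> verts G \<and>
     (\<forall>i < length vs. {vs ! i, vs ! (Suc i mod length vs)} \<in> edges G)"

text \<open>The girth of an acyclic graph is \<open>\<infinity>\<close>, the infimum of the empty set.\<close>

definition girth :: "'a graph \<Rightarrow> enat" where
  "girth G = (INF vs\<in>{vs. is_cycle G vs}. enat (length vs))"

text \<open>
  A plane drawing: vertices are distinct points, edges are simple arcs joining their ends, an arc
  contains no vertex other than its ends, and two arcs meet only in the common ends of their edges.
\<close>

definition plane_drawing ::
  "'a graph \<Rightarrow> ('a \<Rightarrow> real \<times> real) \<Rightarrow> ('a set \<Rightarrow> real \<Rightarrow> real \<times> real) \<Rightarrow> bool" where
  "plane_drawing G p \<gamma> \<longleftrightarrow>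
     inj_on p (verts G) \<and>
     (\<forall>e\<in>edges G. arc (\<gamma> e) \<and> {pathstart (\<gamma> e), pathfinish (\<gamma> e)} = p ` e \<and>
        path_image (\<gamma> e) \<inter> p ` verts G = p ` e) \<and>
     (\<forall>e\<in>edges G. \<forall>e'\<in>edges G. e \<noteq> e' \<longrightarrow>
        path_image (\<gamma> e) \<inter> path_image (\<gamma> e') = p ` (e \<inter> e'))"

definition planar :: "'a graph \<Rightarrow> bool" where
  "planar G \<longleftrightarrow> (\<exists>p \<gamma>. plane_drawing G p \<gamma>)"

datatype edge_sign = Positive | Negative

fun flip :: "edge_sign \<Rightarrow> edge_sign" where
  "flip Positive = Negative"
| "flip Negative = Positive"

text \<open>A signature is a total function on vertex sets; only its values on the edges matter.\<close>

type_synonym 'a signature = "'a set \<Rightarrow> edge_sign"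

definition switch :: "'a set \<Rightarrow> 'a signature \<Rightarrow> 'a signature" where
  "switch X \<sigma> = (\<lambda>e. if card (e \<inter> X) = 1 then flip (\<sigma> e) else \<sigma> e)"

definition switching_equivalent :: "'a graph \<Rightarrow> 'a signature \<Rightarrow> 'a signature \<Rightarrow> bool" where
  "switching_equivalent G \<sigma> \<sigma>' \<longleftrightarrow>
     (\<exists>X. X \<subseteq> verts G \<and> (\<forall>e\<in>edges G. \<sigma>' e = switch X \<sigma> e))"

definition admits_homomorphism ::
  "'a graph \<Rightarrow> 'a signature \<Rightarrow> 'b graph \<Rightarrow> 'b signature \<Rightarrow> bool" where
  "admits_homomorphism G \<sigma> H \<pi> \<longleftrightarrow>
     (\<exists>\<sigma>' f. switching_equivalent G \<sigma> \<sigma>' \<and> f ` verts G \<subseteq> verts H \<and>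
        (\<forall>u v. {u, v} \<in> edges G \<longrightarrow>
           {f u, f v} \<in> edges H \<and> \<pi> {f u, f v} = \<sigma>' {u, v}))"

text \<open>The signed cycle \<open>C\<^sub>-\<^sub>4\<close>, with \<open>u\<^sub>i\<close> encoded as the number \<open>i\<close>.\<close>

definition C4 :: "nat graph" where
  "C4 = \<lparr>verts = {1, 2, 3, 4}, edges = {{1, 2}, {2, 3}, {3, 4}, {4, 1}}\<rparr>"

definition C4_signature :: "nat signature" where
  "C4_signature e = (if e = {4, 1} then Negative else Positive)"

end

theory Submission imports Defs
begin

text \<open>
  Subdividing every edge of a simple planar graph once gives a bipartite planar graph of girth at
  least 6. If the sign of an edge is the product of the signs of its two halves, a homomorphism of
  the subdivision to \<open>C\<^sub>-\<^sub>4\<close> splits the old vertices into two classes, according to the images in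
  \<open>{u\<^sub>1, u\<^sub>2}\<close> and \<open>{u\<^sub>3, u\<^sub>4}\<close>, and the switching set balances the signature on either class.
  So it suffices to find a signed planar graph whose vertices cannot be split into two classes that
  contain no cycle with an odd number of negative edges. Such graphs are the counterexamples to
  four-colorability of signed planar graphs, the first of which is due to Kardos and Narboni.

  The graph used here is a pentagonal bipyramid with poles \<open>0\<close>, \<open>1\<close> and rim \<open>2, 3, 4, 5, 6\<close>. Two
  copies of a fragment put \<open>2\<close> and \<open>3\<close>, respectively \<open>4\<close> and \<open>5\<close>, into different classes. All other
  faces have an odd number of negative edges, except two that are filled with an octahedron, and so
  no face is monochromatic. If the class changes twice around the rim, then the runs have lengths 2
  and 3, and either pole forms a monochromatic face with one of them. If it changes four times, then
  both poles are in the class that occurs twice on the rim, and together with those two rim vertices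
  they form a 4-cycle with an odd number of negative edges.
\<close>

subsection \<open>Subdivisions\<close>

locale subdivision =
  fixes n m :: nat and u v :: "nat \<Rightarrow> nat" and neg :: "nat \<Rightarrow> bool"
  assumes ends_less: "i < m \<Longrightarrow> u i < v i" "i < m \<Longrightarrow> v i < n"
    and simple: "i < m \<Longrightarrow> j < m \<Longrightarrow> u i = u j \<Longrightarrow> v i = v j \<Longrightarrow> i = j"
begin

definition subdivided :: "nat graph" where
  "subdivided = \<lparr>verts = {..<n + m}, edges = (\<Union>i<m. {{u i, n + i}, {v i, n + i}})\<rparr>"

text \<open>The half at \<open>v i\<close> is always positive, so the signs of the two halves
  multiply to the sign of edge \<open>i\<close>.\<close>

definition sigma :: "nat signature" where
  "sigma e = (if \<exists>i<m. e = {u i, n + i} \<and> neg i then Negative else Positive)"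

lemma verts_subdivided [simp]: "verts subdivided = {..<n + m}"
  by (simp add: subdivided_def)

lemma edges_subdivided: "e \<in> edges subdivided \<longleftrightarrow> (\<exists>i<m. \<exists>a\<in>{u i, v i}. e = {a, n + i})"
  by (auto simp: subdivided_def)

lemma end_less: "i < m \<Longrightarrow> a \<in> {u i, v i} \<Longrightarrow> a < n"
  using ends_less[of i] by auto

lemma doubleton_edges_subdivided:
  "{a, b} \<in> edges subdivided \<longleftrightarrow>
     (\<exists>i<m. a \<in> {u i, v i} \<and> b = n + i \<or> b \<in> {u i, v i} \<and> a = n + i)"
  unfolding edges_subdivided doubleton_eq_iff by blast

lemma edge_sides: "{a, b} \<in> edges subdivided \<Longrightarrow> a < n \<longleftrightarrow> \<not> b < n"
  unfolding doubleton_edges_subdivided using end_less by auto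

lemma finite_simple_graph_subdivided: "finite_simple_graph subdivided"
proof -
  have "e \<subseteq> verts subdivided \<and> card e = 2" if "e \<in> edges subdivided" for e
  proof -
    obtain i a where "i < m" "a \<in> {u i, v i}" "e = {a, n + i}"
      using \<open>e \<in> edges subdivided\<close> unfolding edges_subdivided by blast
    then show ?thesis using end_less[of i a] by auto
  qed
  then show ?thesis by (simp add: finite_simple_graph_def)
qed

lemma bipartite_subdivided: "bipartite subdivided"
proof -
  have "\<exists>a\<in>{..<n}. \<exists>b\<in>{n..<n + m}. e = {a, b}" if "e \<in> edges subdivided" for e
  proof -
    obtain i a where "i < m" "a \<in> {u i, v i}" and e: "e = {a, n + i}"
      using \<open>e \<in> edges subdivided\<close> unfolding edges_subdivided by blast
    then have "a \<in> {..<n}" "n + i \<in> {n..<n + m}" using end_less by auto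
    then show ?thesis using e by blast
  qed
  moreover have "{..<n} \<union> {n..<n + m} = verts subdivided" "{..<n} \<inter> {n..<n + m} = {}"
    by auto
  ultimately show ?thesis unfolding bipartite_def by (intro exI[of _ "{..<n}"] exI[of _ "{n..<n + m}"]) simp
qed

lemma same_ends:
  assumes "i < m" "j < m" "a \<noteq> b" "a \<in> {u i, v i}" "b \<in> {u i, v i}" "a \<in> {u j, v j}" "b \<in> {u j, v j}"
  shows "i = j"
  using assms ends_less(1)[of i] ends_less(1)[of j] simple[of i j] by auto

text \<open>Old and new vertices alternate along a cycle, which excludes odd lengths. In a 4-cycle,
  two new vertices would share both old neighbours, against \<open>simple\<close>.\<close>

lemma length_cycle_ge:
  assumes "is_cycle subdivided vs"
  shows "6 \<le> length vs"
proof (rule ccontr)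
  have len: "3 \<le> length vs" and d: "distinct vs"
    and e: "\<And>i. i < length vs \<Longrightarrow> {vs ! i, vs ! (Suc i mod length vs)} \<in> edges subdivided"
    using assms by (auto simp: is_cycle_def)
  assume "\<not> 6 \<le> length vs"
  then consider "length vs = Suc (Suc (Suc 0))" | "length vs = Suc (Suc (Suc (Suc 0)))"
    | "length vs = Suc (Suc (Suc (Suc (Suc 0))))"
    using len by linarith
  then show False
  proof cases
    case 1
    then obtain a b c where vs: "vs = [a, b, c]" by (auto simp: length_Suc_conv)
    have "{a, b} \<in> edges subdivided" "{b, c} \<in> edges subdivided" "{c, a} \<in> edges subdivided"
      using e[of 0] e[of 1] e[of 2] by (simp_all add: vs)
    then show False using edge_sides[of a b] edge_sides[of b c] edge_sides[of c a] by simp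
  next
    case 2
    then obtain a b c d where vs: "vs = [a, b, c, d]" by (auto simp: length_Suc_conv)
    have "{a, b} \<in> edges subdivided" "{b, c} \<in> edges subdivided"
      "{c, d} \<in> edges subdivided" "{d, a} \<in> edges subdivided"
      using e[of 0] e[of 1] e[of 2] e[of 3] by (simp_all add: vs)
    moreover have "a \<noteq> c" "b \<noteq> d" using d by (simp_all add: vs)
    moreover have *: False
      if e: "{x, y} \<in> edges subdivided" "{y, z} \<in> edges subdivided"
        "{z, w} \<in> edges subdivided" "{w, x} \<in> edges subdivided"
        and "x \<noteq> z" "y \<noteq> w" "x < n" for x y z w
    proof -
      have "\<not> y < n" "z < n" "\<not> w < n" using edge_sides[of x y] edge_sides[of y z] edge_sides[of z w] that by simp_all
      then obtain i j where "i < m" "y = n + i" "j < m" "w = n + j"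
        using e(1,3) end_less unfolding doubleton_edges_subdivided by blast
      moreover from this have "x \<in> {u i, v i}" "z \<in> {u i, v i}" "x \<in> {u j, v j}" "z \<in> {u j, v j}"
        using e \<open>x < n\<close> \<open>z < n\<close> unfolding doubleton_edges_subdivided by auto
      ultimately show False using same_ends[of i j x z] \<open>x \<noteq> z\<close> \<open>y \<noteq> w\<close> by blast
    qed
    ultimately show False using *[of a b c d] *[of b c d a] edge_sides[of a b] by blast
  next
    case 3
    then obtain a b c d f where vs: "vs = [a, b, c, d, f]" by (auto simp: length_Suc_conv)
    have "{a, b} \<in> edges subdivided" "{b, c} \<in> edges subdivided" "{c, d} \<in> edges subdivided"
      "{d, f} \<in> edges subdivided" "{f, a} \<in> edges subdivided"
      using e[of 0] e[of 1] e[of 2] e[of 3] e[of 4] by (simp_all add: vs)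
    then show False
      using edge_sides[of a b] edge_sides[of b c] edge_sides[of c d] edge_sides[of d f] edge_sides[of f a]
      by simp
  qed
qed

text \<open>The edges \<open>i\<close>, \<open>j\<close>, \<open>k\<close> form a triangle, and its
  subdivision is a 6-cycle attaining the bound.\<close>

lemma girth_subdivided:
  assumes "i < m" "j < m" "k < m"
    and ijk: "u i = u j" "v i = u k" "v j = v k"
  shows "girth subdivided = 6"
proof (rule antisym)
  note l = ends_less[OF assms(1)] ends_less[OF assms(2)] ends_less[OF assms(3)]
  have ne: "i \<noteq> j" "i \<noteq> k" "j \<noteq> k" using l ijk by auto
  have "{vs ! x, vs ! (Suc x mod 6)} \<in> edges subdivided"
    if "x < 6" and vs: "vs = [u i, n + i, v i, n + k, v k, n + j]" for x vs
  proof -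
    consider "x = 0" | "x = 1" | "x = 2" | "x = 3" | "x = 4" | "x = 5"
      using \<open>x < 6\<close> by linarith
    then show ?thesis
      using assms by cases (auto simp: vs doubleton_edges_subdivided)
  qed
  then have "is_cycle subdivided [u i, n + i, v i, n + k, v k, n + j]"
    using l ne ijk assms(1-3) by (simp add: is_cycle_def)
  then show "girth subdivided \<le> 6"
    unfolding girth_def by (intro INF_lower2) (auto simp: numeral_eq_enat)
  show "6 \<le> girth subdivided"
    unfolding girth_def by (intro INF_greatest) (auto simp: numeral_eq_enat length_cycle_ge)
qed

text \<open>New vertices are placed at the midpoints of straight edges. By \<open>cover\<close>
  every old vertex is an end of some segment, so \<open>segments\<close> also keeps it off all
  segments of which it is not an end.\<close>

lemma planar_subdivided:
  fixes p :: "nat \<Rightarrow> real \<times> real"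
  assumes p: "inj_on p {..<n}"
    and cover: "\<And>w. w < n \<Longrightarrow> \<exists>i<m. w \<in> {u i, v i}"
    and segments: "\<And>i j. i < j \<Longrightarrow> j < m \<Longrightarrow>
      closed_segment (p (u i)) (p (v i)) \<inter> closed_segment (p (u j)) (p (v j))
        \<subseteq> p ` ({u i, v i} \<inter> {u j, v j})"
  shows "planar subdivided"
proof -
  define S where "S i = closed_segment (p (u i)) (p (v i))" for i
  define q where "q k = (if k < n then p k else midpoint (p (u (k - n))) (p (v (k - n))))" for k
  \<comment> \<open>Edges are unordered; \<open>Min\<close> and \<open>Max\<close> pick the old and
    the new end, as \<open>a < n \<le> n + i\<close>.\<close>
  define \<gamma> where "\<gamma> e = linepath (q (Min e)) (q (Max e))" for e
  have p_eq: "p a = p b \<longleftrightarrow> a = b" if "a < n" "b < n" for a b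
    using p that by (auto simp: inj_on_def)
  have q_end: "q a = p a" if "i < m" "a \<in> {u i, v i}" for i a
    using end_less[OF that] by (simp add: q_def)
  have q_mid: "q (n + i) = midpoint (p (u i)) (p (v i))" for i
    by (simp add: q_def)
  have ends_ne: "p (u i) \<noteq> p (v i)" if "i < m" for i
    using ends_less[OF that] p_eq by auto
  have S_Int: "S i \<inter> S j \<subseteq> p ` ({u i, v i} \<inter> {u j, v j})" if "i < m" "j < m" "i \<noteq> j" for i j
  proof (cases "i < j")
    case True
    then show ?thesis using segments that by (simp add: S_def)
  next
    case False
    then have "S j \<inter> S i \<subseteq> p ` ({u j, v j} \<inter> {u i, v i})"
      using segments[of j i] that by (simp add: S_def)
    then show ?thesis by (simp only: Int_commute)
  qed
  have end_in_S: "p a \<in> S i" if "a \<in> {u i, v i}" for a i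
    using that by (auto simp: S_def)
  have S_vertex: "w \<in> {u i, v i}" if "w < n" "i < m" "p w \<in> S i" for w i
  proof -
    from cover[OF \<open>w < n\<close>] obtain j where j: "j < m" "w \<in> {u j, v j}"
      by (elim exE conjE)
    show ?thesis
    proof (cases "i = j")
      case False
      have "p w \<in> p ` ({u i, v i} \<inter> {u j, v j})"
        using S_Int[OF \<open>i < m\<close> j(1) False] \<open>p w \<in> S i\<close> end_in_S[OF j(2)] by (rule subsetD[OF _ IntI])
      then obtain a where a: "p w = p a" "a \<in> {u i, v i}" by (elim imageE IntE)
      then show ?thesis using p_eq[of w a] end_less[OF \<open>i < m\<close> a(2)] \<open>w < n\<close> by simp
    qed (use j in simp)
  qed
  have mid_in_S: "q (n + i) \<in> S i" for i
    by (simp add: q_mid S_def)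
  have mid_not_vertex: "q (n + i) \<noteq> p w" if "i < m" "w < n" for i w
  proof
    assume eq: "q (n + i) = p w"
    then have "w \<in> {u i, v i}" using S_vertex[of w i] that mid_in_S[of i] by simp
    then show False using eq ends_ne[OF \<open>i < m\<close>] by (auto simp: q_mid)
  qed
  have mid_S: "i = j" if "i < m" "j < m" "q (n + i) \<in> S j" for i j
  proof (rule ccontr)
    assume "i \<noteq> j"
    then have "q (n + i) \<in> p ` ({u i, v i} \<inter> {u j, v j})"
      using that by (intro subsetD[OF S_Int IntI] mid_in_S)
    then obtain w where w: "q (n + i) = p w" "w \<in> {u i, v i}" by (elim imageE IntE)
    then show False using mid_not_vertex[OF \<open>i < m\<close> end_less[OF \<open>i < m\<close> w(2)]] by simp
  qed
  define half where "half a i = closed_segment (p a) (q (n + i))" for a i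
  have half_S: "half a i \<subseteq> S i" if "a \<in> {u i, v i}" for a i
    unfolding half_def S_def using mid_in_S[of i] end_in_S[OF that]
    by (simp add: S_def subset_closed_segment)
  have both_halves_Int: "half (u i) i \<inter> half (v i) i = {q (n + i)}" for i
  proof -
    have "closed_segment (p (u i)) (q (n + i)) \<inter> closed_segment (q (n + i)) (p (v i)) = {q (n + i)}"
      by (rule Int_closed_segment) (use mid_in_S[of i] in \<open>simp add: S_def\<close>)
    then show ?thesis
      by (simp only: half_def closed_segment_commute[of "p (v i)"])
  qed
  have halves_Int: "half a i \<inter> half b i = {q (n + i)}"
    if "a \<in> {u i, v i}" "b \<in> {u i, v i}" "a \<noteq> b" for a b i
    using that both_halves_Int[of i] by (elim insertE emptyE) (simp_all add: Int_commute)
  \<comment> \<open>Were \<open>w\<close> the other end of edge \<open>i\<close>, it would lie in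
    both halves and thus be the midpoint, which is no old vertex.\<close>
  have half_vertex: "w = a" if "i < m" "a \<in> {u i, v i}" "w < n" "p w \<in> half a i" for i a w
  proof (rule ccontr)
    assume "w \<noteq> a"
    have "w \<in> {u i, v i}"
      by (rule S_vertex[OF \<open>w < n\<close> \<open>i < m\<close> subsetD[OF half_S]]) (use that in simp_all)
    then have "half a i \<inter> half w i = {q (n + i)}"
      using \<open>a \<in> {u i, v i}\<close> \<open>w \<noteq> a\<close> by (intro halves_Int) simp_all
    moreover have "p w \<in> half w i" by (simp add: half_def)
    ultimately have "p w = q (n + i)" using \<open>p w \<in> half a i\<close> by blast
    then show False using mid_not_vertex[OF \<open>i < m\<close> \<open>w < n\<close>] by simp
  qed
  have inj_q: "inj_on q (verts subdivided)"
  proof (rule inj_onI)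
    fix x y assume xy: "x \<in> verts subdivided" "y \<in> verts subdivided" "q x = q y"
    show "x = y"
    proof (cases "x < n"; cases "y < n")
      assume "x < n" "y < n"
      then show ?thesis using xy p_eq by (simp add: q_def)
    next
      assume "x < n" "\<not> y < n"
      then show ?thesis using xy mid_not_vertex[of "y - n" x] by (simp add: q_def less_diff_conv2)
    next
      assume "\<not> x < n" "y < n"
      then show ?thesis using xy mid_not_vertex[of "x - n" y] by (simp add: q_def less_diff_conv2)
    next
      assume "\<not> x < n" "\<not> y < n"
      moreover from this have "x - n = y - n"
        using xy mid_in_S[of "y - n"] by (intro mid_S) auto
      ultimately show ?thesis by simp
    qed
  qed
  have gamma: "\<gamma> {a, n + i} = linepath (p a) (q (n + i))" if "i < m" "a \<in> {u i, v i}" for a i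
    using end_less[OF that] by (simp add: \<gamma>_def q_def min_def max_def)
  have path_image_gamma: "path_image (\<gamma> {a, n + i}) = half a i" if "i < m" "a \<in> {u i, v i}" for a i
    using that by (simp add: gamma half_def)
  have "plane_drawing subdivided q \<gamma>"
    unfolding plane_drawing_def
  proof (intro conjI ballI impI)
    fix e assume "e \<in> edges subdivided"
    then obtain i a where i: "i < m" "a \<in> {u i, v i}" and e: "e = {a, n + i}"
      unfolding edges_subdivided by blast
    show "arc (\<gamma> e)"
      using i mid_not_vertex[of i a] end_less[OF i] by (auto simp: e gamma)
    show "{pathstart (\<gamma> e), pathfinish (\<gamma> e)} = q ` e"
      by (simp add: e gamma[OF i] q_end[OF i])
    have "x \<in> e" if "x \<in> verts subdivided" "q x \<in> half a i" for x
    proof (cases "x < n")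
      case True
      then show ?thesis using half_vertex[OF i, of x] that by (simp add: e q_def)
    next
      case False
      then have "x - n = i"
        using i that subsetD[OF half_S[OF i(2)], of "q x"] by (intro mid_S) auto
      then show ?thesis using False by (auto simp: e)
    qed
    moreover have "q ` e \<subseteq> half a i"
      by (simp add: e q_end[OF i] half_def)
    moreover have "e \<subseteq> verts subdivided"
      using end_less[OF i] i by (simp add: e)
    ultimately have "half a i \<inter> q ` verts subdivided = q ` e"
      by blast
    then show "path_image (\<gamma> e) \<inter> q ` verts subdivided = q ` e"
      by (simp only: path_image_gamma[OF i] e)
  next
    fix e e' assume "e \<in> edges subdivided" "e' \<in> edges subdivided" and ne: "e \<noteq> e'"
    then obtain i a j b where i: "i < m" "a \<in> {u i, v i}" and e: "e = {a, n + i}"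
      and j: "j < m" "b \<in> {u j, v j}" and e': "e' = {b, n + j}"
      unfolding edges_subdivided by blast
    note ab = end_less[OF i] end_less[OF j]
    have "half a i \<inter> half b j = q ` ({a, n + i} \<inter> {b, n + j})"
    proof (cases "i = j")
      case True
      then have "a \<noteq> b" using ne e e' by auto
      then have "half a i \<inter> half b j = {q (n + i)}"
        using halves_Int[of a i b] i(2) j(2) True by simp
      moreover have "{a, n + i} \<inter> {b, n + j} = {n + i}"
        using ab True \<open>a \<noteq> b\<close> by auto
      ultimately show ?thesis by simp
    next
      case False
      have *: "{a, n + i} \<inter> {b, n + j} = {a} \<inter> {b}"
        using ab False by auto
      have common: "z = p a \<and> a = b" if z: "z \<in> half a i" "z \<in> half b j" for z
      proof -
        have "z \<in> p ` ({u i, v i} \<inter> {u j, v j})"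
          using S_Int[OF i(1) j(1) False] subsetD[OF half_S[OF i(2)] z(1)] subsetD[OF half_S[OF j(2)] z(2)]
          by (rule subsetD[OF _ IntI])
        then obtain w where w: "z = p w" "w \<in> {u i, v i}" by (elim imageE IntE)
        then have "w = a" "w = b"
          using half_vertex[OF i, of w] half_vertex[OF j, of w] z end_less[OF i(1) w(2)] w(1) by auto
        then show ?thesis using w by simp
      qed
      show ?thesis
      proof (cases "a = b")
        case True
        have "p a \<in> half a i" "p a \<in> half b j"
          by (simp_all add: half_def True)
        then have "half a i \<inter> half b j = {p a}"
          using common by blast
        then show ?thesis
          unfolding * using q_end[OF i] True by simp
      next
        case False
        then have "half a i \<inter> half b j = {}"
          using common by blast
        then show ?thesis
          unfolding * using False by simp
      qed
    qed
    then show "path_image (\<gamma> e) \<inter> path_image (\<gamma> e') = q ` (e \<inter> e')"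
      by (simp add: path_image_gamma[OF i] path_image_gamma[OF j] e e')
  qed (rule inj_q)
  then show ?thesis unfolding planar_def by blast
qed

text \<open>A walk of length 2 in the 4-cycle ends where it began or at the opposite vertex, and
  opposite vertices lie in different classes. So if \<open>u i\<close> and \<open>v i\<close> are in
  one class, both halves are mapped to the same edge and their signs cancel.\<close>

lemma homomorphism_imp_coloring:
  assumes "admits_homomorphism subdivided sigma C4 C4_signature"
  obtains p s :: "nat \<Rightarrow> bool"
    where "\<And>i. i < m \<Longrightarrow> p (u i) = p (v i) \<Longrightarrow> (s (u i) \<noteq> s (v i)) = neg i"
proof -
  obtain \<sigma> f where eq: "switching_equivalent subdivided sigma \<sigma>"
    and "\<forall>a b. {a, b} \<in> edges subdivided \<longrightarrow>
      {f a, f b} \<in> edges C4 \<and> C4_signature {f a, f b} = \<sigma> {a, b}"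
    using assms unfolding admits_homomorphism_def by blast
  then have f: "{f a, f b} \<in> edges C4 \<and> C4_signature {f a, f b} = \<sigma> {a, b}"
    if "{a, b} \<in> edges subdivided" for a b
    using that by simp
  obtain X where \<sigma>: "\<forall>e\<in>edges subdivided. \<sigma> e = switch X sigma e"
    using eq unfolding switching_equivalent_def by blast
  \<comment> \<open>The class of \<open>w\<close> is \<open>f w \<le> 2\<close>, and
    \<open>s\<close> is membership in \<open>X\<close>. If \<open>n + i\<close> lies in
    \<open>X\<close>, this flips both halves and cancels in the product.\<close>
  have "(u i \<in> X) \<noteq> (v i \<in> X) \<longleftrightarrow> neg i" if "i < m" and eq: "f (u i) \<le> 2 \<longleftrightarrow> f (v i) \<le> 2" for i
  proof -
    have sw: "switch X sigma {a, n + i} =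
        (if (a \<in> X) \<noteq> (n + i \<in> X) then flip (sigma {a, n + i}) else sigma {a, n + i})"
      if "a < n" for a
    proof -
      have "{a, n + i} \<inter> X = (if a \<in> X then {a} else {}) \<union> (if n + i \<in> X then {n + i} else {})"
        by auto
      then show ?thesis using that by (auto simp: switch_def)
    qed
    have "sigma {u i, n + i} = (if neg i then Negative else Positive)" "sigma {v i, n + i} = Positive"
      using \<open>i < m\<close> ends_less[of i] end_less by (auto simp: sigma_def doubleton_eq_iff)
    then show ?thesis
      using f[of "u i" "n + i"] f[of "v i" "n + i"] \<sigma>[THEN bspec, of "{u i, n + i}"] \<sigma>[THEN bspec, of "{v i, n + i}"]
        sw[of "u i"] sw[of "v i"] ends_less[OF \<open>i < m\<close>] eq \<open>i < m\<close>
      by (auto simp: doubleton_edges_subdivided C4_def C4_signature_def doubleton_eq_iff split: if_splits)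
  qed
  then show thesis by (rule that)
qed

end

subsection \<open>A signed planar graph that is not 4-colorable\<close>

text \<open>A triple \<open>(u, v, b)\<close> is an edge, negative iff \<open>b\<close>. The class of a vertex is given by \<open>p\<close>, and \<open>s\<close>
  is the switching that makes all edges within a class positive.\<close>

definition coloring :: "('a \<Rightarrow> bool) \<Rightarrow> ('a \<Rightarrow> bool) \<Rightarrow> ('a \<times> 'a \<times> bool) list \<Rightarrow> bool" where
  "coloring p s es \<longleftrightarrow> (\<forall>(u, v, b)\<in>set es. p u = p v \<longrightarrow> (s u \<noteq> s v) = b)"

definition rename :: "('a \<Rightarrow> 'b) \<Rightarrow> ('a \<times> 'a \<times> bool) list \<Rightarrow> ('b \<times> 'b \<times> bool) list" where
  "rename g = map (\<lambda>(u, v, b). (g u, g v, b))"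

lemma coloring_Nil: "coloring p s []"
  by (simp add: coloring_def)

lemma coloring_Cons:
  "coloring p s ((u, v, b) # es) \<longleftrightarrow> (p u = p v \<longrightarrow> (s u \<noteq> s v) = b) \<and> coloring p s es"
  by (simp add: coloring_def)

lemma coloring_append: "coloring p s (es @ fs) \<longleftrightarrow> coloring p s es \<and> coloring p s fs"
  by (simp only: coloring_def set_append ball_Un)

lemma coloring_rename: "coloring p s (rename g es) \<longleftrightarrow> coloring (p \<circ> g) (s \<circ> g) es"
  by (simp add: coloring_def rename_def split_beta)

text \<open>The edges of the outer triangle \<open>0, 1, 2\<close> are left out, since they already
  belong to the graph into which the octahedron is glued.\<close>

definition octahedron :: "(nat \<times> nat \<times> bool) list" where
  "octahedron =
    [(0, 3, True), (1, 3, True), (0, 4, True), (2, 4, True), (1, 5, True), (2, 5, False),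
     (3, 4, True), (3, 5, True), (4, 5, True)]"

text \<open>If \<open>0\<close>, \<open>1\<close>, \<open>2\<close> were in one class, then each of \<open>3\<close>, \<open>4\<close>, \<open>5\<close> would be in the other one, as it
  forms a triangle with an odd number of negative edges with two of them; but the triangle
  \<open>3\<close>, \<open>4\<close>, \<open>5\<close> is all negative.\<close>

lemma octahedron_not_monochromatic:
  assumes "coloring p s ([(0, 1, True), (0, 2, True), (1, 2, False)] @ octahedron)"
  shows "\<not> (p 0 = p 1 \<and> p 0 = p 2)"
  using assms unfolding octahedron_def append.simps coloring_Cons coloring_Nil by argo

text \<open>Together with the triangle \<open>0, 1, 2\<close> this is a triangulation whose dual has no Hamiltonian
  cycle avoiding the edge dual to \<open>{0, 1}\<close>, like that of Tutte's fragment. All faces have an odd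
  number of negative edges, except \<open>{7, 5, 10}\<close> and \<open>{3, 9, 10}\<close>. It was found by a computer
  search.\<close>

definition core :: "(nat \<times> nat \<times> bool) list" where
  "core =
    [(0, 6, True), (6, 9, True), (4, 6, True), (4, 8, True), (1, 4, True), (3, 9, True),
     (7, 10, True), (5, 10, False), (2, 9, True), (7, 8, True), (3, 10, True), (1, 8, True),
     (5, 7, True), (8, 10, True), (9, 10, False), (5, 9, True), (2, 5, True), (2, 6, True),
     (3, 4, True), (0, 4, True), (3, 6, True), (1, 5, True), (1, 7, True), (3, 8, True)]"

text \<open>Each list starts with one of the two exceptional faces, its positive edge joining the
  second and third vertex as in \<open>octahedron_not_monochromatic\<close>.\<close>

definition fragment :: "(nat \<times> nat \<times> bool) list" where
  "fragment = core @ rename ((!) [7, 5, 10, 11, 12, 13]) octahedron @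
     rename ((!) [3, 9, 10, 14, 15, 16]) octahedron"

lemma fragment_separates:
  assumes "coloring p s ([(0, 1, True), (0, 2, True), (1, 2, True)] @ fragment)"
  shows "p 0 \<noteq> p 1"
proof -
  let ?g = "(!) [7, 5, 10, 11, 12, 13] :: nat \<Rightarrow> nat" and ?h = "(!) [3, 9, 10, 14, 15, 16] :: nat \<Rightarrow> nat"
  have core: "coloring p s ([(0, 1, True), (0, 2, True), (1, 2, True)] @ core)"
    and g: "coloring (p \<circ> ?g) (s \<circ> ?g) octahedron" and h: "coloring (p \<circ> ?h) (s \<circ> ?h) octahedron"
    using assms by (simp_all only: fragment_def coloring_append coloring_rename)
  have "\<not> (p 7 = p 5 \<and> p 7 = p 10)"
    using octahedron_not_monochromatic[of "p \<circ> ?g" "s \<circ> ?g"] g core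
    by (simp add: core_def coloring_Cons)
  moreover have "\<not> (p 3 = p 9 \<and> p 3 = p 10)"
    using octahedron_not_monochromatic[of "p \<circ> ?h" "s \<circ> ?h"] h core
    by (simp add: core_def coloring_Cons)
  \<comment> \<open>With the two exceptional faces excluded, a propositional problem on the vertices
    0 to 10 remains.\<close>
  ultimately show ?thesis
    using core unfolding core_def append.simps coloring_Cons coloring_Nil by argo
qed

definition bipyramid :: "(nat \<times> nat \<times> bool) list" where
  "bipyramid =
    [(0, 2, True), (0, 3, True), (0, 4, True), (0, 5, True), (0, 6, True),
     (1, 2, True), (1, 3, True), (1, 4, False), (1, 5, False), (1, 6, True),
     (2, 3, True), (3, 4, True), (4, 5, True), (5, 6, True), (2, 6, True)]"

text \<open>The fragments fill the faces \<open>{0, 2, 3}\<close> and \<open>{0, 4, 5}\<close> with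
  14 new vertices each, the octahedra fill \<open>{1, 3, 4}\<close> and \<open>{1, 5, 6}\<close>
  with 3 each: 41 vertices and 15 + 2 * 42 + 2 * 9 = 117 edges in all.\<close>

definition obstruction :: "(nat \<times> nat \<times> bool) list" where
  "obstruction = bipyramid @
    rename ((!) ([2, 3, 0] @ [7..<21])) fragment @ rename ((!) ([4, 5, 0] @ [21..<35])) fragment @
    rename ((!) [3, 1, 4, 35, 36, 37]) octahedron @ rename ((!) [6, 1, 5, 38, 39, 40]) octahedron"

lemma not_colorable: "\<not> coloring p s obstruction"
proof
  assume c: "coloring p s obstruction"
  let ?f = "(!) ([2, 3, 0] @ [7..<21]) :: nat \<Rightarrow> nat" and ?g = "(!) ([4, 5, 0] @ [21..<35]) :: nat \<Rightarrow> nat"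
  let ?h = "(!) [3, 1, 4, 35, 36, 37] :: nat \<Rightarrow> nat" and ?k = "(!) [6, 1, 5, 38, 39, 40] :: nat \<Rightarrow> nat"
  have b: "coloring p s bipyramid"
    and f: "coloring (p \<circ> ?f) (s \<circ> ?f) fragment" and g: "coloring (p \<circ> ?g) (s \<circ> ?g) fragment"
    and h: "coloring (p \<circ> ?h) (s \<circ> ?h) octahedron" and k: "coloring (p \<circ> ?k) (s \<circ> ?k) octahedron"
    using c by (simp_all only: obstruction_def coloring_append coloring_rename)
  have "p 2 \<noteq> p 3"
    using fragment_separates[of "p \<circ> ?f" "s \<circ> ?f"] f b by (simp add: bipyramid_def coloring_Cons)
  moreover have "p 4 \<noteq> p 5"
    using fragment_separates[of "p \<circ> ?g" "s \<circ> ?g"] g b by (simp add: bipyramid_def coloring_Cons)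
  moreover have "\<not> (p 3 = p 1 \<and> p 3 = p 4)"
    using octahedron_not_monochromatic[of "p \<circ> ?h" "s \<circ> ?h"] h b
    by (simp add: bipyramid_def coloring_Cons)
  moreover have "\<not> (p 6 = p 1 \<and> p 6 = p 5)"
    using octahedron_not_monochromatic[of "p \<circ> ?k" "s \<circ> ?k"] k b
    by (simp add: bipyramid_def coloring_Cons)
  ultimately show False
    using b unfolding bipyramid_def coloring_Cons coloring_Nil by argo
qed

subsection \<open>A straight-line drawing\<close>

text \<open>Twice the signed area of the triangle \<open>a\<close>, \<open>b\<close>,
  \<open>c\<close>. The type is generic so that integer computations transfer to real
  points.\<close>

definition orient :: "'a :: linordered_idom \<times> 'a \<Rightarrow> 'a \<times> 'a \<Rightarrow> 'a \<times> 'a \<Rightarrow> 'a" where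
  "orient a b c = (fst b - fst a) * (snd c - snd a) - (snd b - snd a) * (fst c - fst a)"

lemma orient_segment:
  "orient a b ((1 - r) *\<^sub>R c + r *\<^sub>R d) = (1 - r) * orient a b c + r * orient a b d"
  by (simp add: orient_def algebra_simps)

lemma orient_degenerate [simp]: "orient a b a = 0" "orient a b b = 0"
  by (simp_all add: orient_def)

text \<open>\<open>orient a b\<close> is affine in its third argument, vanishes on the first segment
  and has a constant sign on the second.\<close>

lemma closed_segments_disjoint:
  fixes a b c d :: "real \<times> real"
  assumes "0 < orient a b c * orient a b d"
  shows "closed_segment a b \<inter> closed_segment c d = {}"
proof -
  have False if ab: "z \<in> closed_segment a b" and cd: "z \<in> closed_segment c d" for z
  proof -
    obtain t where t: "z = (1 - t) *\<^sub>R a + t *\<^sub>R b"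
      using ab unfolding in_segment by blast
    obtain r where r: "0 \<le> r" "r \<le> 1" "z = (1 - r) *\<^sub>R c + r *\<^sub>R d"
      using cd unfolding in_segment by blast
    have "orient a b z = 0"
      by (simp add: t orient_segment)
    then have e: "(1 - r) * orient a b c + r * orient a b d = 0"
      by (simp add: r(3) orient_segment)
    from assms consider "orient a b c > 0" "orient a b d > 0" | "orient a b c < 0" "orient a b d < 0"
      by (auto simp: zero_less_mult_iff)
    then show False
    proof cases
      case 1
      then show False
        using e r(1,2) convex_bound_lt[of "- orient a b c" 0 "- orient a b d" "1 - r" r] by simp
    next
      case 2
      then show False
        using e r(1,2) convex_bound_lt[of "orient a b c" 0 "orient a b d" "1 - r" r] by simp
    qed
  qed
  then show ?thesis by blast
qed

text \<open>At parameter \<open>r\<close> of the second segment, \<open>orient a b\<close> is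
  \<open>r * orient a b c\<close>, which vanishes only for \<open>r = 0\<close>.\<close>

lemma closed_segments_common_end:
  fixes a b c :: "real \<times> real"
  assumes "orient a b c \<noteq> 0"
  shows "closed_segment a b \<inter> closed_segment a c \<subseteq> {a}"
proof
  fix z assume "z \<in> closed_segment a b \<inter> closed_segment a c"
  then obtain t r where t: "z = (1 - t) *\<^sub>R a + t *\<^sub>R b" and r: "z = (1 - r) *\<^sub>R a + r *\<^sub>R c"
    unfolding in_segment Int_iff by blast
  have "orient a b z = 0"
    by (simp add: t orient_segment)
  then have "r = 0"
    using assms by (simp add: r orient_segment)
  then show "z \<in> {a}"
    by (simp add: r)
qed

text \<open>Positions of the vertices 0 to 40; integer coordinates make the crossing test an exact
  evaluation.\<close>

definition points :: "(int \<times> int) list" where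
  "points =
    [(23, 21), (78, 0), (5, 1), (34, 1), (67, 6), (38, 36), (0, 0), (20, 15), (8, 3),
     (26, 10), (20, 17), (30, 5), (12, 6), (25, 11), (14, 6), (26, 8), (27, 7), (25, 8),
     (21, 13), (19, 13), (19, 12), (40, 32), (38, 35), (27, 24), (50, 22), (32, 29), (35, 29),
     (46, 25), (41, 25), (32, 28), (34, 27), (31, 26), (44, 27), (43, 27), (44, 26), (68, 2),
     (66, 3), (68, 4), (39, 39), (39, 38), (40, 37)]"

text \<open>A sufficient condition for two segments to meet in common ends only: one of them lies
  strictly on one side of the line through the other, or they share an end and are not parallel.\<close>

definition compatible ::
  "(int \<times> int) \<times> (int \<times> int) \<Rightarrow> (int \<times> int) \<times> (int \<times> int) \<Rightarrow> bool" where
  "compatible = (\<lambda>(a, b) (c, d).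
     0 < orient a b c * orient a b d \<or> 0 < orient c d a * orient c d b \<or>
     (a = c \<or> b = c) \<and> orient a b d \<noteq> 0 \<or> (a = d \<or> b = d) \<and> orient a b c \<noteq> 0)"

definition real_point :: "int \<times> int \<Rightarrow> real \<times> real" where
  "real_point a = (of_int (fst a), of_int (snd a))"

lemma orient_real_point:
  "orient (real_point a) (real_point b) (real_point c) = of_int (orient a b c)"
  by (simp add: orient_def real_point_def)

lemma inj_real_point: "inj real_point"
  by (rule injI) (simp add: real_point_def prod_eq_iff)

lemma compatible_segments:
  assumes "compatible (a, b) (c, d)"
  shows "closed_segment (real_point a) (real_point b) \<inter> closed_segment (real_point c) (real_point d)
    \<subseteq> real_point ` ({a, b} \<inter> {c, d})"
proof -
  let ?S = "\<lambda>a b. closed_segment (real_point a) (real_point b)"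
  have disjoint: "?S a b \<inter> ?S c d = {}" if "0 < orient a b c * orient a b d" for a b c d
    using that
    by (intro closed_segments_disjoint) (simp add: orient_real_point flip: of_int_mult)
  have common: "?S a b \<inter> ?S a c \<subseteq> {real_point a}" if "orient a b c \<noteq> 0" for a b c
    using that by (intro closed_segments_common_end) (simp add: orient_real_point)
  have commute: "?S a b = ?S b a" for a b
    by (rule closed_segment_commute)
  \<comment> \<open>When \<open>b\<close> is the common end, \<open>compatible\<close> still tests
    \<open>orient a b\<close>; exchanging \<open>a\<close> and \<open>b\<close> only changes the
    sign.\<close>
  have swap: "orient b a c = - orient a b c" for a b c :: "int \<times> int"
    by (simp add: orient_def algebra_simps)
  consider "0 < orient a b c * orient a b d" | "0 < orient c d a * orient c d b"
    | "a = c" "orient a b d \<noteq> 0" | "b = c" "orient b a d \<noteq> 0"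
    | "a = d" "orient a b c \<noteq> 0" | "b = d" "orient b a c \<noteq> 0"
    using assms swap[of a b c] swap[of a b d] by (auto simp: compatible_def)
  then show ?thesis
  proof cases
    case 1
    then show ?thesis using disjoint by simp
  next
    case 2
    then show ?thesis using disjoint[of c d a b] by (simp add: Int_commute)
  next
    case 3
    show ?thesis using common[OF 3(2)] unfolding 3(1)[symmetric] by blast
  next
    case 4
    show ?thesis using common[OF 4(2)] unfolding commute[of b a] 4(1)[symmetric] by blast
  next
    case 5
    show ?thesis using common[OF 5(2)] unfolding commute[of c a] 5(1)[symmetric] by blast
  next
    case 6
    show ?thesis using common[OF 6(2)] unfolding commute[of a b] commute[of c b] 6(1)[symmetric] by blast
  qed
qed

section \<open>Evaluation of the concrete graph and its drawing\<close>

lemma length_obstruction: "length obstruction = 117"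
  by code_simp

lemma obstruction_ends: "\<forall>(u, v, b)\<in>set obstruction. u < v \<and> v < 41"
  by code_simp

lemma obstruction_simple: "distinct (map (\<lambda>(u, v, b). (u, v)) obstruction)"
  by code_simp

lemma obstruction_covers: "\<forall>w\<in>{..<41}. \<exists>(u, v, b)\<in>set obstruction. w = u \<or> w = v"
  by code_simp

lemma obstruction_triangle:
  "obstruction ! 0 = (0, 2, True)" "obstruction ! 1 = (0, 3, True)" "obstruction ! 10 = (2, 3, True)"
  by code_simp+

lemma points_distinct: "distinct points" "length points = 41"
  by code_simp+

text \<open>\<open>sorted_wrt\<close> tests each of the 117 * 116 / 2 pairs of edges once, which
  matches the hypothesis \<open>i < j\<close> in \<open>planar_subdivided\<close>.\<close>

lemma obstruction_compatible:
  "sorted_wrt compatible (map (\<lambda>(u, v, b). (points ! u, points ! v)) obstruction)"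
  by code_simp

interpretation subdivision 41 117
  "\<lambda>i. fst (obstruction ! i)" "\<lambda>i. fst (snd (obstruction ! i))" "\<lambda>i. snd (snd (obstruction ! i))"
proof
  fix i :: nat assume "i < 117"
  then have "obstruction ! i \<in> set obstruction"
    by (simp add: length_obstruction)
  then show "fst (obstruction ! i) < fst (snd (obstruction ! i))"
    and "fst (snd (obstruction ! i)) < 41"
    using obstruction_ends by (auto simp: case_prod_beta)
next
  fix i j :: nat
  assume "i < 117" "j < 117" "fst (obstruction ! i) = fst (obstruction ! j)"
    "fst (snd (obstruction ! i)) = fst (snd (obstruction ! j))"
  then show "i = j"
    using obstruction_simple
    by (auto simp: distinct_conv_nth length_obstruction case_prod_beta)
qed

lemma not_admits_homomorphism: "\<not> admits_homomorphism subdivided sigma C4 C4_signature"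
proof
  assume "admits_homomorphism subdivided sigma C4 C4_signature"
  then show False
  proof (rule homomorphism_imp_coloring)
    fix p s :: "nat \<Rightarrow> bool"
    assume ps: "\<And>i. i < 117 \<Longrightarrow>
      p (fst (obstruction ! i)) = p (fst (snd (obstruction ! i))) \<Longrightarrow>
      (s (fst (obstruction ! i)) \<noteq> s (fst (snd (obstruction ! i)))) = snd (snd (obstruction ! i))"
    have "\<forall>e\<in>set obstruction. p (fst e) = p (fst (snd e)) \<longrightarrow>
        (s (fst e) \<noteq> s (fst (snd e))) = snd (snd e)"
      using ps by (metis in_set_conv_nth length_obstruction)
    then have "coloring p s obstruction"
      by (simp add: coloring_def case_prod_beta)
    then show False using not_colorable by blast
  qed
qed

lemma planar_subdivided_obstruction: "planar subdivided"
proof (rule planar_subdivided)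
  let ?p = "\<lambda>w. real_point (points ! w)"
  show "inj_on ?p {..<41}"
    using points_distinct by (auto simp: inj_on_def inj_real_point[THEN inj_eq] nth_eq_iff_index_eq)
  show "\<exists>i<117. w \<in> {fst (obstruction ! i), fst (snd (obstruction ! i))}" if "w < 41" for w
  proof -
    have "\<exists>e\<in>set obstruction. w = fst e \<or> w = fst (snd e)"
      using obstruction_covers that by (simp add: case_prod_beta)
    then show ?thesis by (metis in_set_conv_nth insertCI length_obstruction)
  qed
  fix i j :: nat assume ij: "i < j" "j < 117"
  let ?u = "\<lambda>i. fst (obstruction ! i)" and ?v = "\<lambda>i. fst (snd (obstruction ! i))"
  have less: "?u i < 41" "?v i < 41" "?u j < 41" "?v j < 41"
    using end_less[of i] end_less[of j] ij by simp_all
  have "compatible (points ! ?u i, points ! ?v i) (points ! ?u j, points ! ?v j)"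
    using sorted_wrt_nth_less[OF obstruction_compatible, of i j] ij
    by (simp add: length_obstruction case_prod_beta)
  from compatible_segments[OF this]
  show "closed_segment (?p (?u i)) (?p (?v i)) \<inter> closed_segment (?p (?u j)) (?p (?v j))
      \<subseteq> ?p ` ({?u i, ?v i} \<inter> {?u j, ?v j})"
    using less points_distinct by (auto simp: nth_eq_iff_index_eq)
qed

theorem theorem5p3:
  "\<exists>(G :: nat graph) (\<sigma> :: nat signature).
     finite_simple_graph G \<and> bipartite G \<and> planar G \<and> girth G = 6 \<and>
     \<not> admits_homomorphism G \<sigma> C4 C4_signature"
proof (intro exI conjI)
  show "girth subdivided = 6"
    using girth_subdivided[of 0 1 10] obstruction_triangle by simp
qed (fact finite_simple_graph_subdivided bipartite_subdivided planar_subdivided_obstruction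
      not_admits_homomorphism)+

end
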